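(* Let $P\in\mathbb{R}[x]$ be a nonzero polynomial with $P(n)\ge0$ for all $n\in\mathbb{N}_0$, and suppose the move costs are $w_{n,k}=P(n)$ for all $n\in\mathbb{N}_0$ and all $k\in T=\{0,1,2\}$. Let $t_n$ denote the common value $d_{n,0}=d_{n,1}=d_{n,2}$ of the minimal costs. Let $Q\in\mathbb{R}[x]$ be the unique polynomial of the same degree as $P$ such that $2Q(x)-Q(x+1)=P(x)$ for all $x\in\mathbb{R}$. Then for all $n\in\mathbb{N}_0$, $$t_n=\sum_{\nu=0}^{n-1}2^{n-1-\nu}P(\nu)=Q(0)\cdot2^n-Q(n).$$
   Context: For every nonzero $P\in\mathbb{R}[x]$ there is a unique polynomial $Q\in\mathbb{R}[x]$ of the same degree with $2Q(x)-Q(x+1)=P(x)$ for all real $x$. Weighted Tower of Hanoi: $\mathbb{N}_0$ denotes the nonnegative integers; $T=\{0,1,2\}$ is the set of pegs; discs are labelled $1,2,3,\dots$ by increasing size. A state with $n$ discs is an assignment of the discs $1,\dots,n$ to the pegs, the discs on each peg being stacked with smaller discs above larger ones. A legal move transfers the topmost (smallest) disc of one peg to a different peg carrying no smaller disc. For $i\in T$, $i^n$ is the perfect state with all $n$ discs on peg $i$. For $\{i,j,k\}=T$ and $n\in\mathbb{N}_0$, $w_{n,k}\in[0,\infty)$ is a given cost of a single move of disc $n+1$ between pegs $i$ and $j$ (in either direction), and $d_{n,k}$ is the minimal total cost, over all finite sequences of legal moves, of getting from $i^n$ to $j^n$ with $n$ discs. When the costs do not depend on $k$, the values $d_{n,0},d_{n,1},d_{n,2}$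 coincide. An empty sum is zero. *)

theory Defs
  imports Complex_Main "HOL-Library.FuncSet" "HOL-Computational_Algebra.Polynomial"
begin

definition pegs :: "nat set" where
  "pegs = {0, 1, 2}"

text \<open>A state assigns a peg to each of the discs \<open>1, \<dots>, n\<close>. The stacking order on each peg is
  forced, so the assignment determines the configuration.\<close>

definition hanoi_states :: "nat \<Rightarrow> (nat \<Rightarrow> nat) set" where
  "hanoi_states n = {1..n} \<rightarrow>\<^sub>E pegs"

definition perfect :: "nat \<Rightarrow> nat \<Rightarrow> (nat \<Rightarrow> nat)" where
  "perfect n i = (\<lambda>d\<in>{1..n}. i)"

text \<open>\<open>hanoi_move w n s c s'\<close>: one legal move of cost \<open>c\<close> leads from \<open>s\<close> to \<open>s'\<close>.
  Since \<open>pegs\<close> has three elements, \<open>{i, j, k} = pegs\<close> makes \<open>i\<close>, \<open>j\<close>, \<open>k\<close> pairwise distinct, so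
  \<open>k\<close> is the peg not involved in moving disc \<open>d\<close> from \<open>i\<close> to \<open>j\<close>. The cost \<open>w m k\<close> belongs to
  disc \<open>m + 1\<close>, hence the index \<open>d - 1\<close>.\<close>

definition hanoi_move ::
  "(nat \<Rightarrow> nat \<Rightarrow> real) \<Rightarrow> nat \<Rightarrow> (nat \<Rightarrow> nat) \<Rightarrow> real \<Rightarrow> (nat \<Rightarrow> nat) \<Rightarrow> bool" where
  "hanoi_move w n s c s' \<longleftrightarrow>
     s \<in> hanoi_states n \<and>
     (\<exists>d\<in>{1..n}. \<exists>i j k. {i, j, k} = pegs \<and> s d = i \<and>
        (\<forall>e\<in>{1..<d}. s e \<noteq> i) \<and> (\<forall>e\<in>{1..<d}. s e \<noteq> j) \<and>
        s' = s(d := j) \<and> c = w (d - 1) k)"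

text \<open>\<open>hanoi_seq w n s c t\<close>: some finite sequence of legal moves of total cost \<open>c\<close> leads from
  \<open>s\<close> to \<open>t\<close>.\<close>

inductive hanoi_seq ::
  "(nat \<Rightarrow> nat \<Rightarrow> real) \<Rightarrow> nat \<Rightarrow> (nat \<Rightarrow> nat) \<Rightarrow> real \<Rightarrow> (nat \<Rightarrow> nat) \<Rightarrow> bool"
  for w :: "nat \<Rightarrow> nat \<Rightarrow> real" and n :: nat
where
  empty: "s \<in> hanoi_states n \<Longrightarrow> hanoi_seq w n s 0 s"
| step: "hanoi_move w n s c s' \<Longrightarrow> hanoi_seq w n s' c' t \<Longrightarrow> hanoi_seq w n s (c + c') t"

definition is_min_cost :: "(nat \<Rightarrow> nat \<Rightarrow> real) \<Rightarrow> nat \<Rightarrow> nat \<Rightarrow> nat \<Rightarrow> real \<Rightarrow> bool" where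
  "is_min_cost w n i j c \<longleftrightarrow>
     hanoi_seq w n (perfect n i) c (perfect n j) \<and>
     (\<forall>c'. hanoi_seq w n (perfect n i) c' (perfect n j) \<longrightarrow> c \<le> c')"

text \<open>The value \<open>d_min w n k\<close> is the attained minimum common to both orderings of the two pegs
  other than \<open>k\<close>.\<close>

definition d_min :: "(nat \<Rightarrow> nat \<Rightarrow> real) \<Rightarrow> nat \<Rightarrow> nat \<Rightarrow> real" where
  "d_min w n k = (THE c. \<forall>i j. {i, j, k} = pegs \<longrightarrow> is_min_cost w n i j c)"

end

theory Submission
  imports Defs
begin

text \<open>
  Let \<open>p m\<close> be the cost of moving disc \<open>m + 1\<close>. The classical strategy moves the \<open>n\<close> smaller discs out
  of the way, then disc \<open>n + 1\<close>, then the smaller discs on top of it, so its cost \<open>t n\<close> satisfies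
  \<open>t (n + 1) = 2 * t n + p n\<close> (\<open>hanoi_seq_tower_cost\<close>). Solving this recurrence gives the sum, and
  the functional equation of \<open>Q\<close> says precisely that \<open>Q 0 * 2 ^ n - Q n\<close> solves it too.

  Optimality is proved with a potential. The cost that the classical strategy needs from an
  arbitrary state \<open>s\<close> to the perfect state on peg \<open>j\<close> has an explicit recursion over the discs from
  the largest down (\<open>cost_to_perfect\<close>). A single legal move of cost \<open>c\<close> lowers this potential by at
  most \<open>c\<close> (\<open>cost_to_perfect_move\<close>): a move of the largest disc can occur only when all smaller discs
  are stacked on the third peg, and there the potential is known in closed form. As the potential
  vanishes on the target and equals \<open>t n\<close> on every other perfect state, no sequence of moves can be
  cheaper than \<open>t n\<close>. The argument treats all sequences at once, including those that move the
  largest disc several times.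
\<close>

section \<open>The three pegs\<close>

lemma pegs_triple:
  assumes "{i, j, k} = pegs"
  shows "i \<in> pegs" "j \<in> pegs" "k \<in> pegs" "i \<noteq> j" "i \<noteq> k" "j \<noteq> k"
proof -
  have "card {i, j, k} = 3" using assms by (simp add: pegs_def)
  then show "i \<noteq> j" "i \<noteq> k" "j \<noteq> k" by (auto simp: card_insert_if split: if_splits)
  show "i \<in> pegs" "j \<in> pegs" "k \<in> pegs" using assms by blast+
qed

text \<open>The labels of the three pegs add up to 3, which makes the third peg computable.\<close>

lemma pegs_third:
  assumes "i \<in> pegs" "j \<in> pegs" "i \<noteq> j"
  shows "{i, j, 3 - i - j} = pegs"
  using assms by (auto simp: pegs_def)

section \<open>The cost of the classical strategy\<close>

primrec tower_cost :: "(nat \<Rightarrow> real) \<Rightarrow> nat \<Rightarrow> real" where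
  "tower_cost p 0 = 0"
| "tower_cost p (Suc n) = 2 * tower_cost p n + p n"

lemma tower_cost_nonneg:
  assumes "\<And>m. 0 \<le> p m"
  shows "0 \<le> tower_cost p n"
  using assms by (induction n) auto

lemma tower_cost_eq_sum: "tower_cost p n = (\<Sum>\<nu><n. 2 ^ (n - 1 - \<nu>) * p \<nu>)"
proof (induction n)
  case (Suc n)
  have "2 ^ (n - \<nu>) * p \<nu> = 2 * (2 ^ (n - 1 - \<nu>) * p \<nu>)" if "\<nu> < n" for \<nu>
  proof -
    have "n - \<nu> = Suc (n - 1 - \<nu>)" using that by simp
    then show ?thesis by simp
  qed
  then have "(\<Sum>\<nu><n. 2 ^ (n - \<nu>) * p \<nu>) = 2 * (\<Sum>\<nu><n. 2 ^ (n - 1 - \<nu>) * p \<nu>)"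
    unfolding sum_distrib_left by (intro sum.cong) auto
  then show ?case by (simp add: Suc.IH)
qed simp

lemma tower_cost_closed_form:
  fixes q :: "real \<Rightarrow> real"
  assumes "\<And>n::nat. 2 * q (real n) - q (real n + 1) = p n"
  shows "tower_cost p n = q 0 * 2 ^ n - q (real n)"
proof (induction n)
  case (Suc n)
  then show ?case using assms[of n] by (simp add: algebra_simps)
qed simp

section \<open>Upper bound: executing the strategy\<close>

lemma hanoi_seq_trans:
  assumes "hanoi_seq w n s c t" "hanoi_seq w n t c' u"
  shows "hanoi_seq w n s (c + c') u"
  using assms
proof (induction rule: hanoi_seq.induct)
  case (step s c s' c'' t)
  then show ?case by (metis add.assoc hanoi_seq.step)
qed simp

lemma hanoi_states_add_disc:
  assumes "s \<in> hanoi_states n" "b \<in> pegs"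
  shows "s(Suc n := b) \<in> hanoi_states (Suc n)"
  using assms by (auto simp: hanoi_states_def PiE_iff extensional_def le_Suc_eq)

lemma perfect_Suc: "perfect (Suc n) i = (perfect n i)(Suc n := i)"
  by (auto simp: perfect_def fun_eq_iff)

lemma perfect_in_hanoi_states: "i \<in> pegs \<Longrightarrow> perfect n i \<in> hanoi_states n"
  by (auto simp: perfect_def hanoi_states_def)

text \<open>A larger disc at rest never obstructs the smaller ones, wherever it lies.\<close>

lemma hanoi_move_add_disc:
  assumes "hanoi_move w n s c s'" "b \<in> pegs"
  shows "hanoi_move w (Suc n) (s(Suc n := b)) c (s'(Suc n := b))"
proof -
  obtain d i j k where d: "d \<in> {1..n}" and ijk: "{i, j, k} = pegs" and "s d = i"
    and free: "\<forall>e\<in>{1..<d}. s e \<noteq> i" "\<forall>e\<in>{1..<d}. s e \<noteq> j"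
    and "s' = s(d := j)" "c = w (d - 1) k" and s: "s \<in> hanoi_states n"
    using assms(1) unfolding hanoi_move_def by blast
  moreover have "d \<in> {1..Suc n}" "(s(Suc n := b)) d = i"
    "s'(Suc n := b) = (s(Suc n := b))(d := j)"
    using calculation by (auto simp: fun_eq_iff)
  moreover have "\<forall>e\<in>{1..<d}. (s(Suc n := b)) e \<noteq> i" "\<forall>e\<in>{1..<d}. (s(Suc n := b)) e \<noteq> j"
    using d free by auto
  ultimately show ?thesis
    using hanoi_states_add_disc[OF s assms(2)] unfolding hanoi_move_def by blast
qed

lemma hanoi_seq_add_disc:
  assumes "hanoi_seq w n s c t" "b \<in> pegs"
  shows "hanoi_seq w (Suc n) (s(Suc n := b)) c (t(Suc n := b))"
  using assms
  by (induction rule: hanoi_seq.induct)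
    (auto intro: hanoi_seq.intros hanoi_states_add_disc hanoi_move_add_disc)

lemma hanoi_seq_tower_cost:
  assumes "\<And>m k. k \<in> pegs \<Longrightarrow> w m k = p m"
    and "i \<in> pegs" "j \<in> pegs" "i \<noteq> j"
  shows "hanoi_seq w n (perfect n i) (tower_cost p n) (perfect n j)"
  using assms(2-)
proof (induction n arbitrary: i j)
  case 0
  have "perfect 0 i = perfect 0 j" by (auto simp: perfect_def)
  then show ?case using hanoi_seq.empty[OF perfect_in_hanoi_states] 0 by simp
next
  case (Suc n)
  define k where "k = 3 - i - j"
  have ijk: "{i, j, k} = pegs" using pegs_third Suc.prems by (simp add: k_def)
  note pegs = pegs_triple[OF ijk]
  let ?mid = "\<lambda>b. (perfect n k)(Suc n := b)"
  have clear: "hanoi_seq w (Suc n) (perfect (Suc n) i) (tower_cost p n) (?mid i)"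
    unfolding perfect_Suc by (intro hanoi_seq_add_disc Suc.IH pegs)
  have restack: "hanoi_seq w (Suc n) (?mid j) (tower_cost p n) (perfect (Suc n) j)"
    unfolding perfect_Suc by (intro hanoi_seq_add_disc Suc.IH pegs pegs(6)[symmetric])
  have "?mid i \<in> hanoi_states (Suc n)"
    by (intro hanoi_states_add_disc perfect_in_hanoi_states pegs)
  moreover have "\<forall>e\<in>{1..<Suc n}. ?mid i e \<noteq> i" "\<forall>e\<in>{1..<Suc n}. ?mid i e \<noteq> j"
    using pegs by (auto simp: perfect_def)
  moreover have "?mid j = (?mid i)(Suc n := j)" "?mid i (Suc n) = i" "p n = w (Suc n - 1) k"
    using assms(1) pegs by auto
  moreover have "Suc n \<in> {1..Suc n}" by simp
  ultimately have "hanoi_move w (Suc n) (?mid i) (p n) (?mid j)"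
    using ijk unfolding hanoi_move_def by blast
  from hanoi_seq_trans[OF clear hanoi_seq.step[OF this restack]]
  show ?case by (simp add: algebra_simps)
qed

section \<open>Lower bound: a potential on states\<close>

text \<open>
  If the largest disc is off its target \<open>j\<close>, the smaller discs first gather on the third peg
  \<open>3 - s (Suc n) - j\<close>, then the largest disc moves, and a complete tower follows it.
\<close>

primrec cost_to_perfect :: "(nat \<Rightarrow> real) \<Rightarrow> nat \<Rightarrow> (nat \<Rightarrow> nat) \<Rightarrow> nat \<Rightarrow> real" where
  "cost_to_perfect p 0 s j = 0"
| "cost_to_perfect p (Suc n) s j =
     (if s (Suc n) = j then cost_to_perfect p n s j
      else cost_to_perfect p n s (3 - s (Suc n) - j) + p n + tower_cost p n)"

lemma cost_to_perfect_nonneg: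
  assumes "\<And>m. 0 \<le> p m"
  shows "0 \<le> cost_to_perfect p n s j"
  using assms tower_cost_nonneg[OF assms] by (induction n arbitrary: j) auto

lemma cost_to_perfect_larger_disc:
  "n < d \<Longrightarrow> cost_to_perfect p n (s(d := b)) j = cost_to_perfect p n s j"
  by (induction n arbitrary: j) auto

lemma cost_to_perfect_tower:
  assumes "\<forall>e\<in>{1..n}. s e = i" "i \<in> pegs" "j \<in> pegs"
  shows "cost_to_perfect p n s j = (if i = j then 0 else tower_cost p n)"
  using assms
proof (induction n arbitrary: j)
  case (Suc n)
  have "3 - i - j \<in> pegs" "3 - i - j \<noteq> i" if "i \<noteq> j"
    using pegs_triple[OF pegs_third[OF Suc.prems(2,3) that]] by auto
  then show ?case using Suc by auto
qed simp

text \<open>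
  If the largest disc stays in place, both potentials reduce to those of the smaller discs with a
  common new target, so the induction leaves only moves of the largest disc. The potential depends
  on the discs up to \<open>n\<close> alone; taking \<open>s\<close> to be any function on all discs rather than a member of
  \<open>hanoi_states n\<close> lets the induction keep the same \<open>s\<close>.
\<close>

lemma cost_to_perfect_disc_move:
  assumes nonneg: "\<And>m. 0 \<le> p m"
    and "d \<in> {1..n}" "\<forall>e\<in>{1..n}. s e \<in> pegs" "{s d, b, k} = pegs"
    and "\<forall>e\<in>{1..<d}. s e \<noteq> s d" "\<forall>e\<in>{1..<d}. s e \<noteq> b"
    and "j \<in> pegs"
  shows "cost_to_perfect p n s j \<le> p (d - 1) + cost_to_perfect p n (s(d := b)) j"
  using assms(2-)
proof (induction n arbitrary: j)
  case (Suc n)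
  show ?case
  proof (cases "d = Suc n")
    case False
    then have d: "d \<in> {1..n}" "\<forall>e\<in>{1..n}. s e \<in> pegs" using Suc.prems by auto
    have "3 - s (Suc n) - j \<in> pegs" if "s (Suc n) \<noteq> j"
      using pegs_triple(3)[OF pegs_third[OF _ _ that]] Suc.prems by simp
    then show ?thesis
      using Suc.IH[OF d Suc.prems(3-5)] Suc.prems(6) False by simp
  next
    case True
    note pegs = pegs_triple[OF Suc.prems(3)]
    have third: "3 - s d - b = k" "3 - b - k = s d" "3 - s d - k = b"
      using pegs by (auto simp: pegs_def)
    \<comment> \<open>The largest disc is movable only if all others lie on the peg \<open>k\<close>.\<close>
    have "\<forall>e\<in>{1..n}. s e = k"
    proof
      fix e assume "e \<in> {1..n}"
      then have "s e \<in> {s d, b, k}" "s e \<noteq> s d" "s e \<noteq> b" using Suc.prems True by auto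
      then show "s e = k" by blast
    qed
    then have tower: "cost_to_perfect p n s l = (if k = l then 0 else tower_cost p n)"
      if "l \<in> pegs" for l
      using that pegs cost_to_perfect_tower by blast
    have unmoved: "cost_to_perfect p (Suc n) s j =
        (if j = s d then cost_to_perfect p n s j
         else cost_to_perfect p n s (3 - s d - j) + p n + tower_cost p n)"
      using True by auto
    have moved: "cost_to_perfect p (Suc n) (s(d := b)) j =
        (if j = b then cost_to_perfect p n s j
         else cost_to_perfect p n s (3 - b - j) + p n + tower_cost p n)"
      using cost_to_perfect_larger_disc[of n d p s b] True by auto
    have nonneg': "0 \<le> p n" "0 \<le> cost_to_perfect p n s (3 - b - j)"
      using nonneg cost_to_perfect_nonneg by blast+
    consider "j = b" | "j = s d" | "j = k" using Suc.prems by blast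
    then show ?thesis
    proof cases
      case 1
      then show ?thesis
        unfolding moved unmoved using True pegs third tower[of k] tower[of b] by simp
    next
      \<comment> \<open>Leaving the target can only raise the potential, since costs are nonnegative.\<close>
      case 2
      then show ?thesis
        unfolding moved unmoved using True pegs nonneg' tower[of "s d"] by simp
    next
      \<comment> \<open>Moving between the two wrong pegs leaves the potential unchanged.\<close>
      case 3
      then show ?thesis
        unfolding moved unmoved
        using True pegs third nonneg' tower[of "s d"] tower[of b] by simp
    qed
  qed
qed simp

lemma cost_to_perfect_move:
  assumes "\<And>m. 0 \<le> p m" "\<And>m k. k \<in> pegs \<Longrightarrow> w m k = p m"
    and "hanoi_move w n s c s'" "j \<in> pegs"
  shows "cost_to_perfect p n s j \<le> c + cost_to_perfect p n s' j"
proof -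
  obtain d b k where "d \<in> {1..n}" and ijk: "{s d, b, k} = pegs"
    and "\<forall>e\<in>{1..<d}. s e \<noteq> s d" "\<forall>e\<in>{1..<d}. s e \<noteq> b"
    and "s' = s(d := b)" "c = w (d - 1) k" "s \<in> hanoi_states n"
    using assms(3) unfolding hanoi_move_def by blast
  moreover have "w (d - 1) k = p (d - 1)" using assms(2) pegs_triple(3)[OF ijk] .
  moreover have "\<forall>e\<in>{1..n}. s e \<in> pegs"
    using calculation by (auto simp: hanoi_states_def)
  ultimately show ?thesis using cost_to_perfect_disc_move[OF assms(1)] assms(4) by simp
qed

lemma cost_to_perfect_seq:
  assumes "\<And>m. 0 \<le> p m" "\<And>m k. k \<in> pegs \<Longrightarrow> w m k = p m"
    and "hanoi_seq w n s c t" "j \<in> pegs"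
  shows "cost_to_perfect p n s j \<le> c + cost_to_perfect p n t j"
  using assms(3)
proof (induction rule: hanoi_seq.induct)
  case (step s c s' c' t)
  then show ?case using cost_to_perfect_move[OF assms(1,2) step.hyps(1) assms(4)] by simp
qed simp

section \<open>The minimal cost\<close>

lemma is_min_cost_tower_cost:
  assumes "\<And>m. 0 \<le> p m" "\<And>m k. k \<in> pegs \<Longrightarrow> w m k = p m"
    and "i \<in> pegs" "j \<in> pegs" "i \<noteq> j"
  shows "is_min_cost w n i j (tower_cost p n)"
  unfolding is_min_cost_def
proof (intro conjI allI impI)
  show "hanoi_seq w n (perfect n i) (tower_cost p n) (perfect n j)"
    using hanoi_seq_tower_cost assms(2-) by blast
next
  fix c assume "hanoi_seq w n (perfect n i) c (perfect n j)"
  then have "cost_to_perfect p n (perfect n i) j \<le> c + cost_to_perfect p n (perfect n j) j"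
    using cost_to_perfect_seq assms by blast
  moreover have "cost_to_perfect p n (perfect n i) j = tower_cost p n"
    using cost_to_perfect_tower[of n _ i j] assms(3-) by (simp add: perfect_def)
  moreover have "cost_to_perfect p n (perfect n j) j = 0"
    using cost_to_perfect_tower[of n _ j j] assms(4) by (simp add: perfect_def)
  ultimately show "tower_cost p n \<le> c" by simp
qed

lemma d_min_eq_tower_cost:
  assumes "\<And>m. 0 \<le> p m" "\<And>m k. k \<in> pegs \<Longrightarrow> w m k = p m" "k \<in> pegs"
  shows "d_min w n k = tower_cost p n"
  unfolding d_min_def
proof (rule the_equality)
  show minimal: "\<forall>i j. {i, j, k} = pegs \<longrightarrow> is_min_cost w n i j (tower_cost p n)"
  proof (intro allI impI)
    fix i j assume "{i, j, k} = pegs"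
    note pegs = pegs_triple[OF this]
    show "is_min_cost w n i j (tower_cost p n)"
      using is_min_cost_tower_cost[OF assms(1,2) pegs(1,2,4)] .
  qed
  fix c assume c: "\<forall>i j. {i, j, k} = pegs \<longrightarrow> is_min_cost w n i j c"
  \<comment> \<open>Some ordering \<open>i, j\<close> of the other two pegs exists, so the condition on \<open>c\<close> is not vacuous.\<close>
  define i :: nat where "i = (if k = 0 then 1 else 0)"
  have "i \<in> pegs" "i \<noteq> k" by (simp_all add: i_def pegs_def)
  then have "{k, i, 3 - k - i} = pegs" using pegs_third assms(3) by metis
  then have "{i, 3 - k - i, k} = pegs" by blast
  then have "is_min_cost w n i (3 - k - i) c" "is_min_cost w n i (3 - k - i) (tower_cost p n)"
    using c minimal by simp_all
  then show "c = tower_cost p n" unfolding is_min_cost_def by (meson order_antisym)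
qed

theorem theorem4:
  fixes P Q :: "real poly" and w :: "nat \<Rightarrow> nat \<Rightarrow> real"
  assumes "P \<noteq> 0"
    and "\<And>n::nat. poly P (real n) \<ge> 0"
    and "\<And>n k. k \<in> pegs \<Longrightarrow> w n k = poly P (real n)"
    and "degree Q = degree P"
    and "\<And>x::real. 2 * poly Q x - poly Q (x + 1) = poly P x"
  shows "\<forall>n::nat. \<forall>k\<in>pegs.
           d_min w n k = (\<Sum>\<nu><n. 2 ^ (n - 1 - \<nu>) * poly P (real \<nu>)) \<and>
           (\<Sum>\<nu><n. 2 ^ (n - 1 - \<nu>) * poly P (real \<nu>)) = poly Q 0 * 2 ^ n - poly Q (real n)"
proof (intro allI ballI conjI)
  fix n k :: nat
  let ?p = "\<lambda>m. poly P (real m)"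
  show "(\<Sum>\<nu><n. 2 ^ (n - 1 - \<nu>) * poly P (real \<nu>)) = poly Q 0 * 2 ^ n - poly Q (real n)"
    using tower_cost_eq_sum[of ?p n] tower_cost_closed_form[of "poly Q" ?p n] assms(5) by simp
  assume "k \<in> pegs"
  then show "d_min w n k = (\<Sum>\<nu><n. 2 ^ (n - 1 - \<nu>) * poly P (real \<nu>))"
    using d_min_eq_tower_cost[of ?p w k n] tower_cost_eq_sum[of ?p n] assms(2,3) by simp
qed

end
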